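(* Consider a natural gas network on a connected directed graph $\mathcal{G}=(\mathcal{N},\mathcal{P})$ with lossy pipes $\bar{\mathcal{P}}_a$ (coefficients $a_\ell>0$) and compressors $\mathcal{P}_a$ (compression factors $\alpha_\ell>0$). Let $\mathcal{N}$ be partitioned into a nonempty set $\mathcal{N}_\psi$ of nodes whose pressures $\psi_n$ are given and the set $\mathcal{N}_q=\mathcal{N}\setminus\mathcal{N}_\psi$ of nodes whose injections $q_n$ are given. Then the gas flow problem has at most one solution: if $(\mathbf{q},\boldsymbol{\phi},\boldsymbol{\psi})$ and $(\mathbf{q}',\boldsymbol{\phi}',\boldsymbol{\psi}')$ both satisfy the gas flow equations and both agree with the given values $\{\psi_n\}_{n\in\mathcal{N}_\psi}$ and $\{q_n\}_{n\in\mathcal{N}_q}$, then $(\mathbf{q},\boldsymbol{\phi},\boldsymbol{\psi})=(\mathbf{q}',\boldsymbol{\phi}',\boldsymbol{\psi}')$. Equivalently, the gas flow problem has a unique solution whenever it is feasible.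
   Context: Network. $\mathcal{G}=(\mathcal{N},\mathcal{P})$ is a finite directed graph, connected when edge directions are ignored, with $\mathcal{N}=\{1,\dots,N\}$ and $P$ edges; if $(m,n)\in\mathcal{P}$ then $(n,m)\notin\mathcal{P}$. The edge set is partitioned as $\mathcal{P}=\mathcal{P}_a\cup\bar{\mathcal{P}}_a$, with $\mathcal{P}_a$ the ideal compressors and $\bar{\mathcal{P}}_a$ the lossy pipes. The edge-node incidence matrix $\mathbf{A}\in\mathbb{R}^{P\times N}$ has, in the row of $\ell=(m,n)$, entry $+1$ in column $m$, $-1$ in column $n$, and $0$ elsewhere. Compressor convention. Every ideal compressor $(m,n)\in\mathcal{P}_a$ is followed by a lossy pipe: its head node $n$ is an internal junction node whose only incident edges are the compressor $(m,n)$ and one lossy pipe $(n,n')\in\bar{\mathcal{P}}_a$, and its injection is fixed to $q_n=0$ (so $n\in\mathcal{N}_q$ and the flows on the two edges are identical). Gas flow equations. The unknowns are injections $\mathbf{q}\in\mathbb{R}^N$, flows $\boldsymbol{\phi}\in\mathbb{R}^P$, and (squared) pressures $\boldsymbol{\psi}\in\mathbb{R}^N$. The gas flow equations are: (i) $\mathbf{A}^\top\boldsymbol{\phi}=\mathbf{q}$; (ii) $\psi_m-\psi_n=a_\ell\,\mathrm{sign}(\phi_\ell)\phi_\ell^2$ for every lossy pipe $\ell=(m,n)\in\bar{\mathcal{P}}_a$, and $\psi_n\ge 0$ for all $n\in\mathcal{N}$; (iii) $\psi_n=\alpha_\ell\psi_m$ and $\phi_\ell\ge 0$ for every compressor $\ell=(m,n)\in\mathcal{P}_a$.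 Here $\mathrm{sign}(x)$ is $+1,-1,0$ for $x>0$, $x<0$, $x=0$. Gas flow problem. Given $\{\psi_n\}_{n\in\mathcal{N}_\psi}$, $\{q_n\}_{n\in\mathcal{N}_q}$, $\{\alpha_\ell\}_{\ell\in\mathcal{P}_a}$, $\{a_\ell\}_{\ell\in\bar{\mathcal{P}}_a}$, find $(\mathbf{q},\boldsymbol{\phi},\boldsymbol{\psi})$ satisfying (i)-(iii) and agreeing with the given values. *)

theory Defs
  imports Complex_Main "HOL-Library.FuncSet" "Graph_Theory.Digraph_Component"
begin

text \<open>
  Vectors indexed by a finite set \<open>I\<close> (of nodes or edges) are elements of
  \<open>I \<rightarrow>\<^sub>E UNIV\<close>, so that equality of functions is equality of vectors.
\<close>

abbreviation network_graph :: "nat \<Rightarrow> (nat \<times> nat) set \<Rightarrow> nat pair_pre_digraph" where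
  "network_graph N P \<equiv> \<lparr>pverts = {1..N}, parcs = P\<rparr>"

text \<open>
  The constant \<open>Digraph_Component.connected\<close> is connectedness of the underlying
  undirected graph; it has to be qualified because \<open>connected\<close> is also a topological notion.
\<close>

locale gas_network =
  fixes N :: nat
    and P Pa Pl :: "(nat \<times> nat) set"  \<comment> \<open>all edges, compressors, lossy pipes\<close>
    and \<alpha> a :: "nat \<times> nat \<Rightarrow> real"
  assumes finite_graph: "pair_fin_digraph (network_graph N P)"
    and connected_graph: "Digraph_Component.connected (with_proj (network_graph N P))"
    and oriented: "\<And>m n. (m, n) \<in> P \<Longrightarrow> (n, m) \<notin> P"
    and edge_partition: "P = Pa \<union> Pl" "Pa \<inter> Pl = {}"
    and alpha_pos: "\<And>l. l \<in> Pa \<Longrightarrow> \<alpha> l > 0"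
    and a_pos: "\<And>l. l \<in> Pl \<Longrightarrow> a l > 0"

locale gas_flow_problem = gas_network N P Pa Pl \<alpha> a
  for N P Pa Pl \<alpha> a +
  fixes N\<psi> Nq :: "nat set"
    and q_given :: "nat \<Rightarrow> real"
  assumes node_partition: "{1..N} = N\<psi> \<union> Nq" "N\<psi> \<inter> Nq = {}"
    and pressure_nodes_nonempty: "N\<psi> \<noteq> {}"
    and compressor_head_arcs: "\<And>m n. (m, n) \<in> Pa \<Longrightarrow>
      in_arcs (with_proj (network_graph N P)) n = {(m, n)} \<and>
      (\<exists>n'. (n, n') \<in> Pl \<and> out_arcs (with_proj (network_graph N P)) n = {(n, n')})"
    and compressor_head_injection: "\<And>m n. (m, n) \<in> Pa \<Longrightarrow> n \<in> Nq \<and> q_given n = 0"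

definition incidence :: "nat \<times> nat \<Rightarrow> nat \<Rightarrow> real" where
  "incidence l k = (if k = fst l then 1 else if k = snd l then -1 else 0)"

definition gas_flow_equations ::
  "nat \<Rightarrow> (nat \<times> nat) set \<Rightarrow> (nat \<times> nat) set \<Rightarrow> (nat \<times> nat) set \<Rightarrow>
   (nat \<times> nat \<Rightarrow> real) \<Rightarrow> (nat \<times> nat \<Rightarrow> real) \<Rightarrow>
   (nat \<Rightarrow> real) \<Rightarrow> (nat \<times> nat \<Rightarrow> real) \<Rightarrow> (nat \<Rightarrow> real) \<Rightarrow> bool" where
  "gas_flow_equations N P Pa Pl \<alpha> a q \<phi> \<psi> \<longleftrightarrow>
     (\<forall>n\<in>{1..N}. (\<Sum>l\<in>P. incidence l n * \<phi> l) = q n) \<and>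
     (\<forall>(m, n)\<in>Pl. \<psi> m - \<psi> n = a (m, n) * sgn (\<phi> (m, n)) * (\<phi> (m, n))\<^sup>2) \<and>
     (\<forall>n\<in>{1..N}. \<psi> n \<ge> 0) \<and>
     (\<forall>(m, n)\<in>Pa. \<psi> n = \<alpha> (m, n) * \<psi> m \<and> \<phi> (m, n) \<ge> 0)"

definition gas_flow_solution ::
  "nat \<Rightarrow> (nat \<times> nat) set \<Rightarrow> (nat \<times> nat) set \<Rightarrow> (nat \<times> nat) set \<Rightarrow>
   (nat \<times> nat \<Rightarrow> real) \<Rightarrow> (nat \<times> nat \<Rightarrow> real) \<Rightarrow>
   nat set \<Rightarrow> nat set \<Rightarrow> (nat \<Rightarrow> real) \<Rightarrow> (nat \<Rightarrow> real) \<Rightarrow>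
   (nat \<Rightarrow> real) \<times> (nat \<times> nat \<Rightarrow> real) \<times> (nat \<Rightarrow> real) \<Rightarrow> bool" where
  "gas_flow_solution N P Pa Pl \<alpha> a N\<psi> Nq \<psi>_given q_given = (\<lambda>(q, \<phi>, \<psi>).
     q \<in> {1..N} \<rightarrow>\<^sub>E UNIV \<and> \<phi> \<in> P \<rightarrow>\<^sub>E UNIV \<and> \<psi> \<in> {1..N} \<rightarrow>\<^sub>E UNIV \<and>
     gas_flow_equations N P Pa Pl \<alpha> a q \<phi> \<psi> \<and>
     (\<forall>n\<in>N\<psi>. \<psi> n = \<psi>_given n) \<and> (\<forall>n\<in>Nq. q n = q_given n))"

end

theory Submission
  imports Defs
begin

text \<open>
  The proof is a comparison principle. Let \<open>S\<close> be the set of nodes where the pressure of the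
  first solution exceeds that of the second. A compressor multiplies pressures by a positive
  constant, so it never leaves or enters \<open>S\<close>; across a lossy pipe leaving (entering) \<open>S\<close> the
  pressure drop, and hence the flow, of the first solution is strictly larger (smaller).
  Since \<open>S\<close> contains no node of given pressure, both solutions have the same total injection
  into \<open>S\<close>, so no edge crosses the boundary of \<open>S\<close>, and connectedness forces \<open>S = {}\<close>.
\<close>

text \<open>Squaring increases on the nonnegative reals, and the sign factor continues it as an odd
  function. Strict monotonicity translates pressure drops into flows; the injectivity it entails
  recovers pipe flows from pressures.\<close>

lemma sgn_mult_power2_less_iff:
  fixes x y :: real
  shows "sgn x * x\<^sup>2 < sgn y * y\<^sup>2 \<longleftrightarrow> x < y"
proof -
  have *: "sgn u * u\<^sup>2 < sgn v * v\<^sup>2" if "u < v" for u v :: real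
  proof -
    consider "0 \<le> u" | "u < 0" "0 \<le> v" | "v < 0" by linarith
    then show ?thesis
    proof cases
      case 1
      then show ?thesis using that by (auto simp: sgn_if intro: power_strict_mono)
    next
      case 2
      then show ?thesis using that by (auto simp: sgn_if intro: less_le_trans[of _ 0])
    next
      case 3
      then show ?thesis using that power_strict_mono[of "- v" "- u" 2] by (auto simp: sgn_if)
    qed
  qed
  show ?thesis using *[of x y] *[of y x] by (metis less_asym linorder_less_linear)
qed

context gas_network
begin

lemma finite_edges: "finite P"
  using pair_fin_digraph.pair_finite_arcs[OF finite_graph] by simp

lemma edge_ends_in_nodes:
  assumes "(m, n) \<in> P"
  shows "m \<in> {1..N}" "n \<in> {1..N}"
proof -
  interpret G: pair_fin_digraph "network_graph N P" by (rule finite_graph)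
  show "m \<in> {1..N}" "n \<in> {1..N}"
    using G.arc_fst_in_verts[of "(m, n)"] G.arc_snd_in_verts[of "(m, n)"] assms by auto
qed

lemma no_loops: "(n, n) \<notin> P"
  using oriented by blast

lemma boundary_edge_exists:
  assumes "u \<in> {1..N}" "u \<in> S" "v \<in> {1..N}" "v \<notin> S"
  shows "\<exists>(m, n)\<in>P. (m \<in> S) \<noteq> (n \<in> S)"
proof (rule ccontr)
  assume no: "\<not> ?thesis"
  \<comment> \<open>In \<open>?H\<close> every edge may be walked both ways; without a boundary
    edge, membership in \<open>S\<close> is invariant along such a walk.\<close>
  let ?H = "with_proj (mk_symmetric (with_proj (network_graph N P)))"
  have "u \<rightarrow>\<^sup>*\<^bsub>?H\<^esub> v"
    using connected_graph assms(1,3)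
    unfolding Digraph_Component.connected_def strongly_connected_def by simp
  then have "v \<in> S"
    unfolding reachable_def
  proof (induction rule: rtrancl_on_induct)
    case base
    then show ?case using assms(2) by simp
  next
    case (step x y)
    then have "(x, y) \<in> P \<or> (y, x) \<in> P"
      by (auto simp: parcs_mk_symmetric)
    then show ?case using no step by auto
  qed
  with assms(4) show False by simp
qed

lemma sum_incidence:
  assumes "l \<in> P" "S \<subseteq> {1..N}"
  shows "(\<Sum>n\<in>S. incidence l n) = of_bool (fst l \<in> S) - of_bool (snd l \<in> S)"
proof -
  \<comment> \<open>Distinct ends let the nested conditional in \<open>incidence\<close> split into
    a difference of two indicators; on a loop it would yield 1 instead of 0.\<close>
  have "fst l \<noteq> snd l" using no_loops assms(1) by (metis prod.collapse)
  then have "(\<Sum>n\<in>S. incidence l n)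
      = (\<Sum>n\<in>S. (if n = fst l then 1 else 0) - (if n = snd l then 1 else 0))"
    by (intro sum.cong) (auto simp: incidence_def)
  also have "\<dots> = of_bool (fst l \<in> S) - of_bool (snd l \<in> S)"
    using finite_subset[OF assms(2)] by (simp add: sum_subtractf)
  finally show ?thesis .
qed

text \<open>A discrete divergence theorem: edges inside \<open>S\<close> cancel, leaving the net
  outflow through its boundary.\<close>

lemma sum_injections:
  assumes "S \<subseteq> {1..N}"
  shows "(\<Sum>n\<in>S. \<Sum>l\<in>P. incidence l n * f l)
    = (\<Sum>l\<in>P. (of_bool (fst l \<in> S) - of_bool (snd l \<in> S)) * f l)"
proof -
  have "(\<Sum>n\<in>S. \<Sum>l\<in>P. incidence l n * f l) = (\<Sum>l\<in>P. (\<Sum>n\<in>S. incidence l n) * f l)"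
    by (subst sum.swap) (simp add: sum_distrib_right)
  then show ?thesis using assms by (simp add: sum_incidence)
qed

end

context gas_flow_problem
begin

text \<open>An inequality suffices, since the two solutions can be swapped.\<close>

lemma solution_pressure_le:
  assumes sol: "gas_flow_solution N P Pa Pl \<alpha> a N\<psi> Nq \<psi>_given q_given (q, \<phi>, \<psi>)"
    and sol': "gas_flow_solution N P Pa Pl \<alpha> a N\<psi> Nq \<psi>_given q_given (q', \<phi>', \<psi>')"
    and "n \<in> {1..N}"
  shows "\<psi> n \<le> \<psi>' n"
proof (rule ccontr)
  assume "\<not> \<psi> n \<le> \<psi>' n"
  define S where "S = {k \<in> {1..N}. \<psi>' k < \<psi> k}"
  let ?c = "\<lambda>l. of_bool (fst l \<in> S) - of_bool (snd l \<in> S) :: real"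
  have S: "S \<subseteq> {1..N}" "n \<in> S"
    using \<open>\<not> \<psi> n \<le> \<psi>' n\<close> assms(3) by (auto simp: S_def)
  have given: "\<psi> k = \<psi>' k" if "k \<in> N\<psi>" for k
    using sol sol' that by (simp add: gas_flow_solution_def)
  \<comment> \<open>The coefficient \<open>?c l\<close> is 1 on edges leaving \<open>S\<close>, -1
    on edges entering it and 0 on all others.\<close>
  have crossing: "?c l * (\<phi> l - \<phi>' l) > 0" if "l \<in> P" "(fst l \<in> S) \<noteq> (snd l \<in> S)" for l
  proof -
    obtain i j where l: "l = (i, j)" by (cases l)
    have ends: "i \<in> {1..N}" "j \<in> {1..N}" using edge_ends_in_nodes that(1) l by auto
    have "l \<notin> Pa"
    proof
      assume "l \<in> Pa"
      then have "\<psi> j = \<alpha> l * \<psi> i" "\<psi>' j = \<alpha> l * \<psi>' i" "\<alpha> l > 0"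
        using sol sol' l alpha_pos by (auto simp: gas_flow_solution_def gas_flow_equations_def)
      then show False using that(2) ends l by (simp add: S_def)
    qed
    then have "l \<in> Pl" using that(1) edge_partition(1) by blast
    then have drop: "\<psi> i - \<psi> j = a l * (sgn (\<phi> l) * (\<phi> l)\<^sup>2)"
        "\<psi>' i - \<psi>' j = a l * (sgn (\<phi>' l) * (\<phi>' l)\<^sup>2)" and "a l > 0"
      using sol sol' l a_pos
      by (auto simp: gas_flow_solution_def gas_flow_equations_def mult.assoc)
    show ?thesis
    proof (cases "i \<in> S")
      case True
      \<comment> \<open>The end in \<open>S\<close> gives a strict inequality, the end outside only
        a weak one; together they are strict.\<close>
      then have "\<psi>' i - \<psi>' j < \<psi> i - \<psi> j" using that(2) ends l by (simp add: S_def)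
      then have "\<phi>' l < \<phi> l"
        using \<open>a l > 0\<close> by (simp add: drop sgn_mult_power2_less_iff)
      then show ?thesis using True that(2) l by simp
    next
      case False
      then have "\<psi> i - \<psi> j < \<psi>' i - \<psi>' j" using that(2) ends l by (simp add: S_def)
      then have "\<phi> l < \<phi>' l"
        using \<open>a l > 0\<close> by (simp add: drop sgn_mult_power2_less_iff)
      then show ?thesis using False that(2) l by simp
    qed
  qed
  have "(\<Sum>l\<in>P. incidence l k * \<phi> l) = (\<Sum>l\<in>P. incidence l k * \<phi>' l)" if "k \<in> S" for k
  proof -
    have "k \<in> {1..N}" "k \<notin> N\<psi>" using that given[of k] unfolding S_def by auto
    then have "k \<in> Nq" unfolding node_partition(1) by blast
    then show ?thesis
      using sol sol' that by (simp add: gas_flow_solution_def gas_flow_equations_def S_def)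
  qed
  then have "(\<Sum>l\<in>P. ?c l * \<phi> l) = (\<Sum>l\<in>P. ?c l * \<phi>' l)"
    using sum_injections[OF S(1), of \<phi>] sum_injections[OF S(1), of \<phi>'] by simp
  then have zero: "(\<Sum>l\<in>P. ?c l * (\<phi> l - \<phi>' l)) = 0"
    by (simp add: right_diff_distrib sum_subtractf)
  \<comment> \<open>A node of prescribed pressure lies outside \<open>S\<close>, so connectedness
    yields a boundary edge, whose positive term contradicts \<open>zero\<close>.\<close>
  obtain v where "v \<in> N\<psi>" using pressure_nodes_nonempty by blast
  then have "v \<in> {1..N}" "v \<notin> S" using node_partition given by (auto simp: S_def)
  with boundary_edge_exists[of n S v] S assms(3)
  obtain l where l: "l \<in> P" "(fst l \<in> S) \<noteq> (snd l \<in> S)" by fastforce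
  have "(\<Sum>l\<in>P. ?c l * (\<phi> l - \<phi>' l)) > 0"
  proof (rule sum_pos2[OF finite_edges l(1)])
    show "0 < ?c l * (\<phi> l - \<phi>' l)" using crossing[OF l] .
    show "0 \<le> ?c k * (\<phi> k - \<phi>' k)" if "k \<in> P" for k
      using crossing[OF that] by (cases "(fst k \<in> S) = (snd k \<in> S)") auto
  qed
  with zero show False by simp
qed

text \<open>This is flow balance at the head node, which has zero injection and only these two
  edges. It is needed because the compressor law does not tie flow to pressure.\<close>

lemma compressor_flow_eq_pipe_flow:
  assumes sol: "gas_flow_solution N P Pa Pl \<alpha> a N\<psi> Nq \<psi>_given q_given (q, \<phi>, \<psi>)"
    and "(m, n) \<in> Pa" "out_arcs (with_proj (network_graph N P)) n = {(n, n')}"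
  shows "\<phi> (m, n) = \<phi> (n, n')"
proof -
  have edges: "{l \<in> P. snd l = n} = {(m, n)}" "{l \<in> P. fst l = n} = {(n, n')}"
    using compressor_head_arcs[OF assms(2)] assms(3) by (auto simp: in_arcs_def out_arcs_def)
  have "n \<in> {1..N}" "q n = 0"
    using sol compressor_head_injection[OF assms(2)] node_partition
    by (auto simp: gas_flow_solution_def)
  then have "0 = (\<Sum>l\<in>P. incidence l n * \<phi> l)"
    using sol by (simp add: gas_flow_solution_def gas_flow_equations_def)
  also have "\<dots> = (\<Sum>l\<in>{(m, n), (n, n')}. incidence l n * \<phi> l)"
    using edges by (intro sum.mono_neutral_right finite_edges) (auto simp: incidence_def)
  also have "\<dots> = \<phi> (n, n') - \<phi> (m, n)"
  proof -
    \<comment> \<open>This makes the two edges distinct, so the sum really has two terms.\<close>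
    have "m \<noteq> n" using assms(2) no_loops edge_partition(1) by blast
    then show ?thesis by (simp add: incidence_def)
  qed
  finally show ?thesis by simp
qed

text \<open>Pressures determine pipe flows, these determine compressor flows, and all flows together
  determine the injections.\<close>

lemma solution_unique:
  assumes sol: "gas_flow_solution N P Pa Pl \<alpha> a N\<psi> Nq \<psi>_given q_given (q, \<phi>, \<psi>)"
    and sol': "gas_flow_solution N P Pa Pl \<alpha> a N\<psi> Nq \<psi>_given q_given (q', \<phi>', \<psi>')"
  shows "(q, \<phi>, \<psi>) = (q', \<phi>', \<psi>')"
proof -
  \<comment> \<open>Off their index sets these functions are all \<open>undefined\<close>, so
    agreement on nodes or edges is equality.\<close>
  have ext: "q \<in> {1..N} \<rightarrow>\<^sub>E UNIV" "\<phi> \<in> P \<rightarrow>\<^sub>E UNIV" "\<psi> \<in> {1..N} \<rightarrow>\<^sub>E UNIV"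
      "q' \<in> {1..N} \<rightarrow>\<^sub>E UNIV" "\<phi>' \<in> P \<rightarrow>\<^sub>E UNIV" "\<psi>' \<in> {1..N} \<rightarrow>\<^sub>E UNIV"
    using sol sol' by (simp_all add: gas_flow_solution_def)
  have pressure: "\<psi> = \<psi>'"
    using solution_pressure_le[OF sol sol'] solution_pressure_le[OF sol' sol]
    by (intro PiE_ext[OF ext(3,6)] antisym)
  have pipe: "\<phi> l = \<phi>' l" if "l \<in> Pl" for l
  proof -
    obtain m n where l: "l = (m, n)" by (cases l)
    have "\<psi> m - \<psi> n = a l * sgn (\<phi> l) * (\<phi> l)\<^sup>2"
      using sol that l by (auto simp: gas_flow_solution_def gas_flow_equations_def)
    moreover have "\<psi>' m - \<psi>' n = a l * sgn (\<phi>' l) * (\<phi>' l)\<^sup>2"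
      using sol' that l by (auto simp: gas_flow_solution_def gas_flow_equations_def)
    ultimately have "a l * (sgn (\<phi> l) * (\<phi> l)\<^sup>2) = a l * (sgn (\<phi>' l) * (\<phi>' l)\<^sup>2)"
      by (auto simp: pressure mult.assoc)
    then have "sgn (\<phi> l) * (\<phi> l)\<^sup>2 = sgn (\<phi>' l) * (\<phi>' l)\<^sup>2"
      using a_pos[OF that] by (metis less_irrefl mult_left_cancel)
    then show ?thesis by (metis less_irrefl linorder_less_linear sgn_mult_power2_less_iff)
  qed
  have compressor: "\<phi> (m, n) = \<phi>' (m, n)" if mn: "(m, n) \<in> Pa" for m n
  proof -
    obtain n' where n': "(n, n') \<in> Pl"
        "out_arcs (with_proj (network_graph N P)) n = {(n, n')}"
      using compressor_head_arcs[OF mn] by blast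
    show ?thesis
      using compressor_flow_eq_pipe_flow[OF sol mn n'(2)]
        compressor_flow_eq_pipe_flow[OF sol' mn n'(2)] pipe[OF n'(1)] by simp
  qed
  have flow: "\<phi> = \<phi>'"
    using pipe compressor edge_partition(1) by (intro PiE_ext[OF ext(2,5)]) auto
  have "q = q'"
  proof (rule PiE_ext[OF ext(1,4)])
    fix n assume "n \<in> {1..N}"
    then show "q n = q' n"
      using sol sol' flow by (auto simp: gas_flow_solution_def gas_flow_equations_def)
  qed
  with pressure flow show ?thesis by simp
qed

end

theorem theorem2:
  fixes N :: nat
    and P Pa Pl :: "(nat \<times> nat) set"
    and \<alpha> a :: "nat \<times> nat \<Rightarrow> real"
    and N\<psi> Nq :: "nat set"
    and \<psi>_given q_given :: "nat \<Rightarrow> real"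
  assumes "gas_flow_problem N P Pa Pl \<alpha> a N\<psi> Nq q_given"
  shows "(\<forall>q \<phi> \<psi> q' \<phi>' \<psi>'.
            gas_flow_solution N P Pa Pl \<alpha> a N\<psi> Nq \<psi>_given q_given (q, \<phi>, \<psi>) \<longrightarrow>
            gas_flow_solution N P Pa Pl \<alpha> a N\<psi> Nq \<psi>_given q_given (q', \<phi>', \<psi>') \<longrightarrow>
            (q, \<phi>, \<psi>) = (q', \<phi>', \<psi>')) \<and>
         ((\<exists>x. gas_flow_solution N P Pa Pl \<alpha> a N\<psi> Nq \<psi>_given q_given x) \<longrightarrow>
          (\<exists>!x. gas_flow_solution N P Pa Pl \<alpha> a N\<psi> Nq \<psi>_given q_given x))"
proof -
  interpret gas_flow_problem N P Pa Pl \<alpha> a N\<psi> Nq q_given by (rule assms)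
  have "x = y"
    if "gas_flow_solution N P Pa Pl \<alpha> a N\<psi> Nq \<psi>_given q_given x"
      and "gas_flow_solution N P Pa Pl \<alpha> a N\<psi> Nq \<psi>_given q_given y" for x y
    using that solution_unique by (cases x; cases y) blast
  then show ?thesis by blast
qed

end
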